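(* Let $n \geq 7$ and let $G = CS_{6,n-6}$ be the cycle-star graph with cycle length $k=6$ and $n-k \geq 1$ pendant vertices. Then $es(G) = n-3$ if $n \in \{7,8\}$, and $es(G) = n-4$ if $n \geq 9$.
   Context: For integers $k \geq 3$ and $n > k$, the cycle-star graph $CS_{k,n-k}$ is the simple graph on $n$ vertices consisting of a cycle of length $k$ together with $n-k$ additional vertices of degree one (leaves), all adjacent to the same single vertex of the cycle. For a simple graph $G$, a vertex $k$-labeling is a map $\phi: V(G) \to \{1,2,\ldots,k\}$; the weight of an edge $uv$ is $w_\phi(uv) = \phi(u)+\phi(v)$. The labeling is an edge irregular $k$-labeling if distinct edges have distinct weights. The edge irregularity strength $es(G)$ is the minimum $k$ for which $G$ admits an edge irregular $k$-labeling. *)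

theory Defs
  imports Main "HOL-Library.Nat_Bijection"
begin

type_synonym 'a graph = "'a set \<times> 'a set set"

abbreviation verts :: "'a graph \<Rightarrow> 'a set" where "verts \<equiv> fst"
abbreviation edges :: "'a graph \<Rightarrow> 'a set set" where "edges \<equiv> snd"

definition finite_simple_graph :: "'a graph \<Rightarrow> bool" where
  "finite_simple_graph G \<longleftrightarrow>
     finite (verts G) \<and> (\<forall>e\<in>edges G. \<exists>u v. u \<in> verts G \<and> v \<in> verts G \<and> u \<noteq> v \<and> e = {u, v})"

definition vertex_labeling :: "'a graph \<Rightarrow> nat \<Rightarrow> ('a \<Rightarrow> nat) \<Rightarrow> bool" where
  "vertex_labeling G k \<phi> \<longleftrightarrow> \<phi> ` verts G \<subseteq> {1..k}"

definition edge_weight :: "('a \<Rightarrow> nat) \<Rightarrow> 'a set \<Rightarrow> nat" where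
  "edge_weight \<phi> e = (\<Sum>v\<in>e. \<phi> v)"

lemma edge_weight_pair: "u \<noteq> v \<Longrightarrow> edge_weight \<phi> {u, v} = \<phi> u + \<phi> v"
  by (simp add: edge_weight_def)

definition edge_irregular_labeling :: "'a graph \<Rightarrow> nat \<Rightarrow> ('a \<Rightarrow> nat) \<Rightarrow> bool" where
  "edge_irregular_labeling G k \<phi> \<longleftrightarrow>
     vertex_labeling G k \<phi> \<and>
     (\<forall>e\<in>edges G. \<forall>f\<in>edges G. e \<noteq> f \<longrightarrow> edge_weight \<phi> e \<noteq> edge_weight \<phi> f)"

definition edge_irregularity_strength :: "'a graph \<Rightarrow> nat" where
  "edge_irregularity_strength G = (LEAST k. \<exists>\<phi>. edge_irregular_labeling G k \<phi>)"

text \<open>The minimum above is taken over a nonempty set: label the vertices by distinct powers of 2.\<close>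

lemma edge_irregular_labeling_exists:
  assumes "finite_simple_graph G"
  shows "\<exists>k \<phi>. edge_irregular_labeling G k \<phi>"
proof -
  have fin: "finite (verts G)"
    using assms by (simp add: finite_simple_graph_def)
  have sub: "e \<subseteq> verts G" if "e \<in> edges G" for e
    using assms that by (auto simp: finite_simple_graph_def)
  obtain f :: "'a \<Rightarrow> nat" where f: "inj_on f (verts G)"
    using finite_imp_inj_to_nat_seg[OF fin] by blast
  define \<phi> where "\<phi> v = (2::nat) ^ f v" for v
  define k where "k = Max (\<phi> ` verts G)"
  have weight: "edge_weight \<phi> e = set_encode (f ` e)" if "e \<in> edges G" for e
    unfolding edge_weight_def set_encode_def \<phi>_def
    by (subst sum.reindex[OF inj_on_subset[OF f sub[OF that]]]) (simp add: o_def)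
  have "e = e'" if "e \<in> edges G" "e' \<in> edges G" "edge_weight \<phi> e = edge_weight \<phi> e'" for e e'
  proof -
    have "finite (f ` e)" "finite (f ` e')"
      using finite_subset[OF sub fin] that by auto
    moreover have "set_encode (f ` e) = set_encode (f ` e')"
      using that weight by simp
    ultimately have "f ` e = f ` e'"
      by (simp add: set_encode_eq)
    then show ?thesis
      using inj_on_image_eq_iff[OF f sub[OF that(1)] sub[OF that(2)]] by simp
  qed
  moreover have "vertex_labeling G k \<phi>"
    using fin by (auto simp: vertex_labeling_def k_def \<phi>_def)
  ultimately show ?thesis
    unfolding edge_irregular_labeling_def by blast
qed

text \<open>\<open>cycle_star k m\<close> is $CS_{k,m}$: the cycle is \<open>0, \<dots>, k - 1\<close>, and the leaves
  \<open>k, \<dots>, k + m - 1\<close> are attached to the cycle vertex \<open>0\<close>.\<close>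

definition cycle_star :: "nat \<Rightarrow> nat \<Rightarrow> nat graph" where
  "cycle_star k m =
     ({..<k + m}, {{i, Suc i mod k} | i. i < k} \<union> {{0, j} | j. k \<le> j \<and> j < k + m})"

lemma finite_simple_graph_cycle_star:
  assumes "3 \<le> k"
  shows "finite_simple_graph (cycle_star k m)"
proof -
  have cyc: "Suc i mod k < k + m \<and> i \<noteq> Suc i mod k" if "i < k" for i
  proof (cases "Suc i = k")
    case False
    then have "Suc i < k" using that by simp
    then show ?thesis by simp
  qed (use assms in auto)
  show ?thesis
    unfolding finite_simple_graph_def cycle_star_def fst_conv snd_conv
  proof (intro conjI ballI)
    fix e
    assume "e \<in> {{i, Suc i mod k} | i. i < k} \<union> {{0, j} | j. k \<le> j \<and> j < k + m}"
    then show "\<exists>u v. u \<in> {..<k + m} \<and> v \<in> {..<k + m} \<and> u \<noteq> v \<and> e = {u, v}"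
    proof (elim UnE CollectE exE conjE)
      fix i assume i: "e = {i, Suc i mod k}" "i < k"
      show ?thesis
        by (rule exI[of _ i], rule exI[of _ "Suc i mod k"]) (use cyc[OF i(2)] i in simp)
    next
      fix j assume j: "e = {0, j}" "k \<le> j" "j < k + m"
      show ?thesis
        by (rule exI[of _ 0], rule exI[of _ j]) (use assms j in simp)
    qed
  qed simp
qed

end

theory Submission
  imports Defs
begin

text \<open>The labels of the \<open>n - 4\<close> neighbours of the centre are pairwise distinct, so
  \<open>es(G) \<ge> n - 4\<close>; the \<open>n\<close> edge weights lie in \<open>{2..2 * es(G)}\<close>, so \<open>n \<le> 2 * es(G) - 1\<close>, which is
  the stronger bound for \<open>n \<in> {7, 8}\<close>. For \<open>n \<ge> 9\<close> put \<open>K = n - 4\<close> and label the cycle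
  \<open>1, K, K, K - 1, K - 1, K - 2\<close>, starting at the centre, and the leaves with the remaining elements
  of \<open>{1..K}\<close>: the star has weights \<open>2, \<dots>, K + 1\<close>, and the other four edges have
  \<open>2 * K - 3, \<dots>, 2 * K\<close>.\<close>

text \<open>The graph has as many edges as vertices, so edges are indexed by vertices: cycle edges
  by their start, leaf edges by their leaf. Irregularity then becomes injectivity of
  \<open>cs_weight\<close> on an interval.\<close>

definition cs_edge :: "nat \<Rightarrow> nat \<Rightarrow> nat set" where
  "cs_edge k i = (if i < k then {i, Suc i mod k} else {0, i})"

definition cs_weight :: "nat \<Rightarrow> (nat \<Rightarrow> nat) \<Rightarrow> nat \<Rightarrow> nat" where
  "cs_weight k \<phi> i = (if i < k then \<phi> i + \<phi> (Suc i mod k) else \<phi> 0 + \<phi> i)"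

lemma verts_cycle_star: "verts (cycle_star k m) = {..<k + m}"
  by (simp add: cycle_star_def)

lemma edges_cycle_star: "edges (cycle_star k m) = cs_edge k ` {..<k + m}"
proof -
  have "{..<k + m} = {..<k} \<union> {k..<k + m}" by auto
  moreover have "cs_edge k ` {..<k} = {{i, Suc i mod k} | i. i < k}"
    by (auto simp: cs_edge_def)
  moreover have "cs_edge k ` {k..<k + m} = {{0, j} | j. k \<le> j \<and> j < k + m}"
    by (auto simp: cs_edge_def)
  ultimately show ?thesis by (simp add: cycle_star_def image_Un)
qed

lemma Suc_mod_neq:
  assumes "3 \<le> k" "i < k"
  shows "Suc i mod k \<noteq> i"
  using assms by (cases "Suc i = k") auto

lemma edge_weight_cs_edge:
  assumes "3 \<le> k"
  shows "edge_weight \<phi> (cs_edge k i) = cs_weight k \<phi> i"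
  using assms Suc_mod_neq[of k i] edge_weight_pair[of i "Suc i mod k" \<phi>]
    edge_weight_pair[of 0 i \<phi>]
  by (auto simp: cs_edge_def cs_weight_def)

text \<open>Only a leaf edge contains a vertex \<ge> \<open>k\<close>, and that vertex is its index.
  Two cycle edges with different indices could agree only if each index were the successor of the
  other modulo \<open>k\<close>, which forces \<open>k\<close> \<le> 2.\<close>

lemma inj_cs_edge:
  assumes "3 \<le> k"
  shows "inj (cs_edge k)"
proof (rule injI)
  fix i j assume eq: "cs_edge k i = cs_edge k j"
  have lt: "Suc l mod k < k" for l using assms by simp
  show "i = j"
  proof (cases "i < k \<and> j < k")
    case True
    have "Suc l mod k = (if Suc l = k then 0 else Suc l)" if "l < k" for l
      using that by auto
    then show ?thesis using True eq assms
      by (auto simp: cs_edge_def doubleton_eq_iff split: if_splits)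
  next
    case False
    then show ?thesis using eq lt[of i] lt[of j] assms
      by (auto simp: cs_edge_def doubleton_eq_iff split: if_splits)
  qed
qed

lemma edge_irregular_labeling_cycle_star_iff:
  assumes "3 \<le> k"
  shows "edge_irregular_labeling (cycle_star k m) K \<phi> \<longleftrightarrow>
    \<phi> ` {..<k + m} \<subseteq> {1..K} \<and> inj_on (cs_weight k \<phi>) {..<k + m}"
  unfolding edge_irregular_labeling_def vertex_labeling_def verts_cycle_star edges_cycle_star
    ball_simps edge_weight_cs_edge[OF assms] inj_eq[OF inj_cs_edge[OF assms]] inj_on_def
  by blast

text \<open>All edges at the centre share the summand \<open>\<phi> 0\<close>, so distinct weights
  force distinct labels on its neighbours: \<open>m\<close> leaves and two cycle vertices.\<close>

lemma edge_irregular_labeling_cycle_star_degree_bound: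
  assumes "3 \<le> k" "edge_irregular_labeling (cycle_star k m) K \<phi>"
  shows "m + 2 \<le> K"
proof -
  have rng: "\<phi> ` {..<k + m} \<subseteq> {1..K}" and inj: "inj_on (cs_weight k \<phi>) {..<k + m}"
    using assms by (auto simp: edge_irregular_labeling_cycle_star_iff)
  \<comment> \<open>\<open>I\<close> indexes the edges at the centre, and \<open>g i\<close> is the other end of edge \<open>i\<close>.\<close>
  define I where "I = insert 0 {k - 1..<k + m}"
  have card: "card I = m + 2"
    using assms by (simp add: I_def)
  define g where "g i = (if i = 0 then 1 else i)" for i :: nat
  have w: "cs_weight k \<phi> i = \<phi> 0 + \<phi> (g i)" if "i \<in> I" for i
  proof -
    \<comment> \<open>Edge \<open>k - 1\<close> closes the cycle at 0, so its other end is its own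
      index, as for a leaf edge.\<close>
    consider "i = 0" | "i = k - 1" | "k \<le> i" using \<open>i \<in> I\<close> by (force simp: I_def)
    then show ?thesis using assms by cases (auto simp: g_def cs_weight_def)
  qed
  have "inj_on (cs_weight k \<phi>) I"
    by (rule inj_on_subset[OF inj]) (use assms in \<open>auto simp: I_def\<close>)
  then have "inj_on (\<lambda>i. \<phi> (g i)) I"
    by (simp add: inj_on_def w)
  moreover have "(\<lambda>i. \<phi> (g i)) ` I \<subseteq> {1..K}"
  proof -
    have "g i \<in> {..<k + m}" if "i \<in> I" for i
      using that assms by (auto simp: I_def g_def)
    then show ?thesis using rng by blast
  qed
  ultimately show ?thesis
    using card_inj_on_le[of _ I "{1..K}"] card by simp
qed

text \<open>Pigeonhole: \<open>k + m\<close> distinct weights lie in a set of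
  \<open>2 * K - 1\<close> values.\<close>

lemma edge_irregular_labeling_cycle_star_size_bound:
  assumes "3 \<le> k" "edge_irregular_labeling (cycle_star k m) K \<phi>"
  shows "k + m + 1 \<le> 2 * K"
proof -
  have rng: "\<phi> i \<in> {1..K}" if "i < k + m" for i
    using assms that by (auto simp: edge_irregular_labeling_cycle_star_iff)
  have inj: "inj_on (cs_weight k \<phi>) {..<k + m}"
    using assms by (auto simp: edge_irregular_labeling_cycle_star_iff)
  have "cs_weight k \<phi> i \<in> {2..2 * K}" if "i < k + m" for i
  proof -
    have "Suc i mod k < k + m" using assms by (simp add: trans_less_add1)
    then show ?thesis
      using rng[of i] rng[of 0] rng[of "Suc i mod k"] that assms
      by (auto simp: cs_weight_def)
  qed
  then have "cs_weight k \<phi> ` {..<k + m} \<subseteq> {2..2 * K}" by auto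
  from card_inj_on_le[OF inj this] assms show ?thesis by simp
qed

lemma edge_irregular_labeling_cycle_star_6:
  assumes "3 \<le> m"
  shows "\<exists>\<phi>. edge_irregular_labeling (cycle_star 6 m) (m + 2) \<phi>"
proof -
  \<comment> \<open>The leaves before the last get 1, ..., \<open>m - 1\<close>; cycle vertex 5
    takes \<open>m\<close>, so the last leaf, \<open>m + 5\<close>, skips to
    \<open>m + 1\<close>.\<close>
  define \<phi> where "\<phi> i = (if i = 0 then 1 else if i \<le> 2 then m + 2 else if i \<le> 4 then m + 1
    else if i = 5 then m else if i = m + 5 then m + 1 else i - 5)" for i :: nat
  have "\<phi> ` {..<6 + m} \<subseteq> {1..m + 2}"
    using assms by (auto simp: \<phi>_def)
  moreover have "inj_on (cs_weight 6 \<phi>) {..<6 + m}"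
  proof -
    have low: "cs_weight 6 \<phi> i = (if i = 0 then m + 3 else if i = 1 then 2 * m + 4
      else if i = 2 then 2 * m + 3 else if i = 3 then 2 * m + 2 else if i = 4 then 2 * m + 1
      else m + 1)" if "i < 6" for i
    proof -
      have "i \<in> {0, 1, 2, 3, 4, 5}" using that by auto
      then show ?thesis using assms by (auto simp: cs_weight_def \<phi>_def)
    qed
    have high: "cs_weight 6 \<phi> i = (if i = m + 5 then m + 2 else i - 4)" if "6 \<le> i" for i
      using that by (auto simp: cs_weight_def \<phi>_def)
    \<comment> \<open>Here \<open>m\<close> \<ge> 3 matters: it puts \<open>2 * m + 1\<close> above
      \<open>m + 3\<close>, the largest weight at the centre.\<close>
    have "inj_on (cs_weight 6 \<phi>) {0, 1, 2, 3, 4, 5}"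
      using assms by (simp add: low)
    moreover have "inj_on (cs_weight 6 \<phi>) {6..<6 + m}"
    proof (rule inj_onI)
      fix i j assume "i \<in> {6..<6 + m}" "j \<in> {6..<6 + m}" "cs_weight 6 \<phi> i = cs_weight 6 \<phi> j"
      then show "i = j" using high[of i] high[of j] by (simp split: if_splits)
    qed
    moreover have "cs_weight 6 \<phi> i \<noteq> cs_weight 6 \<phi> j"
      if "i \<in> {0, 1, 2, 3, 4, 5}" "j \<in> {6..<6 + m}" for i j
    proof -
      \<comment> \<open>Edge 5 fills the gap \<open>m + 1\<close> between the leaf weights.\<close>
      have "cs_weight 6 \<phi> j \<noteq> m + 1 \<and> cs_weight 6 \<phi> j \<le> m + 2"
        using that(2) by (auto simp: high)
      moreover have "cs_weight 6 \<phi> i = m + 1 \<or> m + 3 \<le> cs_weight 6 \<phi> i"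
        using that(1) assms by (auto simp: low)
      ultimately show ?thesis by linarith
    qed
    ultimately have "inj_on (cs_weight 6 \<phi>) ({0, 1, 2, 3, 4, 5} \<union> {6..<6 + m})"
      unfolding inj_on_Un by blast
    moreover have "{..<6 + m} = {0, 1, 2, 3, 4, 5} \<union> {6..<6 + m}" by auto
    ultimately show ?thesis by simp
  qed
  ultimately show ?thesis
    by (auto simp: edge_irregular_labeling_cycle_star_iff)
qed

lemma edge_irregular_labeling_cycle_star_6_1:
  "\<exists>\<phi>. edge_irregular_labeling (cycle_star 6 1) 4 \<phi>"
proof (rule exI)
  have "{..<6 + 1 :: nat} = {0, 1, 2, 3, 4, 5, 6}" by auto
  \<comment> \<open>The weights are 2, 3, 6, 8, 7, 4, 5, which exhaust
    \<open>{2..8}\<close>.\<close>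
  then show "edge_irregular_labeling (cycle_star 6 1) 4 (\<lambda>i. [1, 1, 2, 4, 4, 3, 4] ! i)"
    by (simp add: edge_irregular_labeling_cycle_star_iff cs_weight_def)
qed

lemma edge_irregular_labeling_cycle_star_6_2:
  "\<exists>\<phi>. edge_irregular_labeling (cycle_star 6 2) 5 \<phi>"
proof (rule exI)
  have "{..<6 + 2 :: nat} = {0, 1, 2, 3, 4, 5, 6, 7}" by auto
  \<comment> \<open>The weights are 2, 3, 7, 9, 8, 5, 4, 6.\<close>
  then show "edge_irregular_labeling (cycle_star 6 2) 5 (\<lambda>i. [1, 1, 2, 5, 4, 4, 3, 5] ! i)"
    by (simp add: edge_irregular_labeling_cycle_star_iff cs_weight_def)
qed

lemma edge_irregularity_strength_eqI:
  assumes "\<exists>\<phi>. edge_irregular_labeling G k \<phi>"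
    and "\<And>K \<phi>. edge_irregular_labeling G K \<phi> \<Longrightarrow> k \<le> K"
  shows "edge_irregularity_strength G = k"
  unfolding edge_irregularity_strength_def using assms by (intro Least_equality) blast+

theorem theorem3p5:
  fixes n :: nat
  assumes "n \<ge> 7"
  shows "(n \<in> {7, 8} \<longrightarrow> edge_irregularity_strength (cycle_star 6 (n - 6)) = n - 3) \<and>
         (n \<ge> 9 \<longrightarrow> edge_irregularity_strength (cycle_star 6 (n - 6)) = n - 4)"
proof (intro conjI impI)
  assume n: "n \<in> {7, 8}"
  show "edge_irregularity_strength (cycle_star 6 (n - 6)) = n - 3"
  proof (rule edge_irregularity_strength_eqI)
    show "\<exists>\<phi>. edge_irregular_labeling (cycle_star 6 (n - 6)) (n - 3) \<phi>"
      using n edge_irregular_labeling_cycle_star_6_1 edge_irregular_labeling_cycle_star_6_2 by auto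
    \<comment> \<open>From \<open>n + 1 \<le> 2 * K\<close>: \<open>K\<close> \<ge> 4 for
      \<open>n = 7\<close>, and \<open>K\<close> \<ge> 5 for \<open>n = 8\<close> after rounding
      up.\<close>
    show "n - 3 \<le> K" if "edge_irregular_labeling (cycle_star 6 (n - 6)) K \<phi>" for K \<phi>
      using edge_irregular_labeling_cycle_star_size_bound[OF _ that] n by auto
  qed
next
  assume n: "n \<ge> 9"
  show "edge_irregularity_strength (cycle_star 6 (n - 6)) = n - 4"
  proof (rule edge_irregularity_strength_eqI)
    have "n - 6 + 2 = n - 4" using n by simp
    then show "\<exists>\<phi>. edge_irregular_labeling (cycle_star 6 (n - 6)) (n - 4) \<phi>"
      using edge_irregular_labeling_cycle_star_6[of "n - 6"] n by simp
    show "n - 4 \<le> K" if "edge_irregular_labeling (cycle_star 6 (n - 6)) K \<phi>" for K \<phi>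
      using edge_irregular_labeling_cycle_star_degree_bound[OF _ that] n by simp
  qed
qed

end
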